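(* Let $G$ and $F$ be locally Abelian graphs (locally finite, simple and connected) and let $\phi$ be a connection on $G$ with values in $\mathrm{Aut}(F)$ that is balanced on every loop of length $4$ in $G$. Then the graph bundle $G\times_\phi F$ is a locally Abelian graph.
   Context: Graph bundle: Let $G=(V_G,E_G)$ and $F=(V_F,E_F)$ be locally finite, simple, connected graphs and let $E_G^{or}=\{(x,y): x,y\in V_G,\ x\sim y\}$ be the set of oriented edges of $G$. A connection is a map $\phi:E_G^{or}\to \mathrm{Aut}(F)$, $(x,y)\mapsto\phi_{yx}$, into the group of graph automorphisms of $F$, such that $\phi_{xy}=\phi_{yx}^{-1}$. The graph bundle $G\times_\phi F$ is the graph with vertex set $V_G\times V_F$ in which $(x,v)\sim(y,w)$ if and only if either (i) $x=y$ and $v\sim w$ in $F$, or (ii) $x\sim y$ in $G$ and $w=\phi_{yx}(v)$. Balanced loops: A loop of length $N$ in $G$ is a sequence of vertices $\{x_i\}_{i=0}^N$ with $x_i\sim x_{i+1}$ for $0\le i\le N-1$ and $x_0=x_N$ (vertices may repeat). It is balanced (with respect to $\phi$) if $\phi_{x_Nx_{N-1}}\circ\cdots\circ\phi_{x_2x_1}\circ\phi_{x_1x_0}=\mathrm{id}\in\mathrm{Aut}(F)$. Locally Abelian (also called S-Ricci flat): A $d$-regular simple graph with vertex set $V$ is locally Abelian if for every $x\in V$, writing $B_1(x)=\{x\}\cup\{y\in V:y\sim x\}$, there exist maps $\eta_i:B_1(x)\to V$, $1\le i\le d$, such that (i) $\eta_i(u)\sim u$ for all $u\in B_1(x)$ and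 all $i$; (ii) for all $u\in B_1(x)$: $\eta_i(u)=\eta_j(u)$ if and only if $i=j$; (iii) for every $i$, $\bigcup_j\{\eta_i(\eta_j(x))\}=\bigcup_j\{\eta_j(\eta_i(x))\}$; (iv) $\eta_i(\eta_j(x))=\eta_j(\eta_i(x))$ for all $i,j$. *)

theory Defs
  imports "Graph_Theory.Digraph_Component" "HOL-Combinatorics.Permutations"
begin

text \<open>
  A simple undirected graph, possibly infinite, is a \<open>pair_bidirected_digraph\<close>: a symmetric
  irreflexive set of pairs over a vertex set.
\<close>

definition locally_finite :: "'a pair_pre_digraph \<Rightarrow> bool" where
  "locally_finite G \<longleftrightarrow> (\<forall>x \<in> pverts G. finite (out_arcs (with_proj G) x))"

text \<open>Finiteness is stated separately since \<open>out_degree\<close> is \<open>0\<close> for infinitely many arcs.\<close>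

definition regular_of_degree :: "'a pair_pre_digraph \<Rightarrow> nat \<Rightarrow> bool" where
  "regular_of_degree G d \<longleftrightarrow>
    (\<forall>x \<in> pverts G. finite (out_arcs (with_proj G) x) \<and> out_degree (with_proj G) x = d)"

text \<open>
  Automorphisms are represented by total functions that are the identity outside the vertex set,
  so that equality in \<open>Aut(F)\<close> is equality of functions, the neutral element is \<open>id\<close> and
  the group inverse is \<open>inv\<close>.
\<close>

definition graph_Aut :: "'a pair_pre_digraph \<Rightarrow> ('a \<Rightarrow> 'a) set" where
  "graph_Aut F = {f. f permutes pverts F \<and>
    (\<forall>v \<in> pverts F. \<forall>w \<in> pverts F. (v, w) \<in> parcs F \<longleftrightarrow> (f v, f w) \<in> parcs F)}"

text \<open>
  The automorphism attached to the oriented edge \<open>(x, y)\<close>, usually written $\phi_{yx}$, is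
  \<open>\<phi> y x\<close>; values of \<open>\<phi>\<close> off the edges are irrelevant.
\<close>

definition is_connection ::
  "'a pair_pre_digraph \<Rightarrow> 'b pair_pre_digraph \<Rightarrow> ('a \<Rightarrow> 'a \<Rightarrow> 'b \<Rightarrow> 'b) \<Rightarrow> bool" where
  "is_connection G F \<phi> \<longleftrightarrow>
    (\<forall>(x, y) \<in> parcs G. \<phi> y x \<in> graph_Aut F \<and> \<phi> x y = inv (\<phi> y x))"

definition graph_bundle ::
  "'a pair_pre_digraph \<Rightarrow> ('a \<Rightarrow> 'a \<Rightarrow> 'b \<Rightarrow> 'b) \<Rightarrow> 'b pair_pre_digraph
    \<Rightarrow> ('a \<times> 'b) pair_pre_digraph" where
  "graph_bundle G \<phi> F =
    \<lparr> pverts = pverts G \<times> pverts F,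
      parcs = {((x, v), (y, w)) | x v y w.
        (x, v) \<in> pverts G \<times> pverts F \<and> (y, w) \<in> pverts G \<times> pverts F \<and>
        (x = y \<and> (v, w) \<in> parcs F \<or> (x, y) \<in> parcs G \<and> w = \<phi> y x v)} \<rparr>"

text \<open>Only the values \<open>x 0, \<dots>, x N\<close> matter.\<close>

definition is_loop :: "'a pair_pre_digraph \<Rightarrow> nat \<Rightarrow> (nat \<Rightarrow> 'a) \<Rightarrow> bool" where
  "is_loop G N x \<longleftrightarrow>
    (\<forall>i \<le> N. x i \<in> pverts G) \<and> (\<forall>i < N. (x i, x (Suc i)) \<in> parcs G) \<and> x 0 = x N"

primrec transport :: "('a \<Rightarrow> 'a \<Rightarrow> 'b \<Rightarrow> 'b) \<Rightarrow> (nat \<Rightarrow> 'a) \<Rightarrow> nat \<Rightarrow> 'b \<Rightarrow> 'b" where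
  "transport \<phi> x 0 = id"
| "transport \<phi> x (Suc n) = \<phi> (x (Suc n)) (x n) \<circ> transport \<phi> x n"

definition balanced :: "('a \<Rightarrow> 'a \<Rightarrow> 'b \<Rightarrow> 'b) \<Rightarrow> nat \<Rightarrow> (nat \<Rightarrow> 'a) \<Rightarrow> bool" where
  "balanced \<phi> N x \<longleftrightarrow> transport \<phi> x N = id"

definition unit_ball :: "'a pair_pre_digraph \<Rightarrow> 'a \<Rightarrow> 'a set" where
  "unit_ball G x = {x} \<union> {y \<in> pverts G. (y, x) \<in> parcs G}"

definition locally_abelian :: "'a pair_pre_digraph \<Rightarrow> bool" where
  "locally_abelian G \<longleftrightarrow> pair_bidirected_digraph G \<and>
    (\<exists>d. regular_of_degree G d \<and>
      (\<forall>x \<in> pverts G. \<exists>\<eta> :: nat \<Rightarrow> 'a \<Rightarrow> 'a.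
        (\<forall>i \<in> {1..d}. \<forall>u \<in> unit_ball G x. \<eta> i u \<in> pverts G) \<and>
        (\<forall>i \<in> {1..d}. \<forall>u \<in> unit_ball G x. (\<eta> i u, u) \<in> parcs G) \<and>
        (\<forall>u \<in> unit_ball G x. \<forall>i \<in> {1..d}. \<forall>j \<in> {1..d}. \<eta> i u = \<eta> j u \<longleftrightarrow> i = j) \<and>
        (\<forall>i \<in> {1..d}. (\<Union>j \<in> {1..d}. {\<eta> i (\<eta> j x)}) = (\<Union>j \<in> {1..d}. {\<eta> j (\<eta> i x)})) \<and>
        (\<forall>i \<in> {1..d}. \<forall>j \<in> {1..d}. \<eta> i (\<eta> j x) = \<eta> j (\<eta> i x))))"

end

theory Submission
  imports Defs
begin

text \<open>
  The vertices of the bundle near \<open>(x, v)\<close> carry two families of moves. A commuting frame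
  \<open>\<eta>\<close> of \<open>G\<close> at \<open>x\<close> gives \<^emph>\<open>horizontal\<close> moves: walk from \<open>y\<close> to \<open>\<eta> i y\<close> and carry the
  fibre coordinate along with the connection. A commuting frame \<open>\<theta>\<close> of \<open>F\<close> at \<open>v\<close> gives
  \<^emph>\<open>vertical\<close> moves: stay over \<open>y\<close>, carry the fibre coordinate back to the fibre over the
  centre \<open>x\<close>, apply \<open>\<theta> j\<close> there, and carry the result back to the fibre over \<open>y\<close>.

  Together they give \<open>d + e\<close> moves, the degree of the bundle. They lead to different neighbours
  because a horizontal move changes the base point, a vertical move keeps it, and within each
  family the two given frames separate the moves. At the centre they commute in pairs,
  for three different reasons. Two vertical moves commute because \<open>\<theta>\<close> does. A
  horizontal and a vertical move commute because the vertical moves over a neighbour \<open>y\<close> of \<open>x\<close>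
  are, by their construction, the conjugates of those over \<open>x\<close> by the connection along \<open>(x, y)\<close>.
  Two horizontal moves lead to the same base point because \<open>\<eta>\<close> commutes, along two paths
  that together form a loop of length 4; balance of this loop (\<open>balanced_square\<close>) says exactly that
  the fibre coordinates agree too.
\<close>

section \<open>Commuting frames\<close>

definition commuting_frame :: "'a pair_pre_digraph \<Rightarrow> nat \<Rightarrow> 'a \<Rightarrow> (nat \<Rightarrow> 'a \<Rightarrow> 'a) \<Rightarrow> bool" where
  "commuting_frame G d x \<eta> \<longleftrightarrow>
    (\<forall>i \<in> {1..d}. \<forall>u \<in> unit_ball G x. (\<eta> i u, u) \<in> parcs G) \<and>
    (\<forall>u \<in> unit_ball G x. inj_on (\<lambda>i. \<eta> i u) {1..d}) \<and>
    (\<forall>i \<in> {1..d}. \<forall>j \<in> {1..d}. \<eta> i (\<eta> j x) = \<eta> j (\<eta> i x))"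

text \<open>
  Pairwise commutation makes the two unions in the definition of a locally Abelian graph equal
  term by term, so a commuting frame is all that has to be produced at each vertex.
\<close>

lemma locally_abelian_iff_commuting_frame:
  "locally_abelian G \<longleftrightarrow> pair_bidirected_digraph G \<and>
    (\<exists>d. regular_of_degree G d \<and> (\<forall>x \<in> pverts G. \<exists>\<eta>. commuting_frame G d x \<eta>))"
proof (cases "pair_bidirected_digraph G")
  case True
  then interpret pair_bidirected_digraph G .
  have "((\<forall>i \<in> {1..d}. \<forall>u \<in> unit_ball G x. \<eta> i u \<in> pverts G) \<and>
        (\<forall>i \<in> {1..d}. \<forall>u \<in> unit_ball G x. (\<eta> i u, u) \<in> parcs G) \<and>
        (\<forall>u \<in> unit_ball G x. \<forall>i \<in> {1..d}. \<forall>j \<in> {1..d}. \<eta> i u = \<eta> j u \<longleftrightarrow> i = j) \<and>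
        (\<forall>i \<in> {1..d}. (\<Union>j \<in> {1..d}. {\<eta> i (\<eta> j x)}) = (\<Union>j \<in> {1..d}. {\<eta> j (\<eta> i x)})) \<and>
        (\<forall>i \<in> {1..d}. \<forall>j \<in> {1..d}. \<eta> i (\<eta> j x) = \<eta> j (\<eta> i x)))
      \<longleftrightarrow> commuting_frame G d x \<eta>" for d x and \<eta> :: "nat \<Rightarrow> 'a \<Rightarrow> 'a"
    unfolding commuting_frame_def inj_on_def by (blast dest: in_arcsD1)
  with True show ?thesis
    unfolding locally_abelian_def by simp
qed (simp add: locally_abelian_def)

lemma regular_of_degree_iff_card_neighbours:
  "regular_of_degree G d \<longleftrightarrow>
    (\<forall>x \<in> pverts G. finite (parcs G `` {x}) \<and> card (parcs G `` {x}) = d)"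
proof -
  have out_arcs: "out_arcs (with_proj G) x = Pair x ` (parcs G `` {x})" for x
    by (auto simp: out_arcs_def)
  have "finite (out_arcs (with_proj G) x) \<longleftrightarrow> finite (parcs G `` {x})" for x
    unfolding out_arcs by (rule finite_image_iff) (simp add: inj_on_def)
  moreover have "out_degree (with_proj G) x = card (parcs G `` {x})" for x
    unfolding out_degree_def out_arcs by (rule card_image) (simp add: inj_on_def)
  ultimately show ?thesis
    by (simp add: regular_of_degree_def)
qed

section \<open>Connections and graph bundles\<close>

lemma graph_Aut_bij: "f \<in> graph_Aut F \<Longrightarrow> bij f"
  by (auto simp: graph_Aut_def intro: permutes_bij)

lemma id_in_graph_Aut: "id \<in> graph_Aut F"
  by (simp add: graph_Aut_def permutes_id)

lemma graph_Aut_vertex: "f \<in> graph_Aut F \<Longrightarrow> f v \<in> pverts F \<longleftrightarrow> v \<in> pverts F"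
  by (simp add: graph_Aut_def permutes_in_image)

locale bundle_connection =
  base: pair_bidirected_digraph G + fibre: pair_bidirected_digraph F
  for G :: "'a pair_pre_digraph" and F :: "'b pair_pre_digraph" +
  fixes \<phi> :: "'a \<Rightarrow> 'a \<Rightarrow> 'b \<Rightarrow> 'b"
  assumes connection: "is_connection G F \<phi>"
begin

lemma connection_Aut: "(x, y) \<in> parcs G \<Longrightarrow> \<phi> y x \<in> graph_Aut F"
  using connection by (auto simp: is_connection_def)

lemma connection_back: "(x, y) \<in> parcs G \<Longrightarrow> \<phi> x y (\<phi> y x v) = v"
  using connection connection_Aut[of x y]
  by (auto simp: is_connection_def dest!: graph_Aut_bij bij_is_inj)

lemma graph_Aut_arc: "f \<in> graph_Aut F \<Longrightarrow> (v, w) \<in> parcs F \<Longrightarrow> (f v, f w) \<in> parcs F"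
  by (auto simp: graph_Aut_def dest: fibre.in_arcsD1 fibre.in_arcsD2)

text \<open>
  Arcs of \<open>F\<close> and automorphisms of \<open>F\<close> lead from vertices of \<open>F\<close> to vertices of \<open>F\<close>, so
  the end point of an arc lies in the bundle as soon as its starting point does.
\<close>

lemma bundle_arc_iff:
  "((x, v), (y, w)) \<in> parcs (graph_bundle G \<phi> F) \<longleftrightarrow>
    x \<in> pverts G \<and> v \<in> pverts F \<and>
    (x = y \<and> (v, w) \<in> parcs F \<or> (x, y) \<in> parcs G \<and> w = \<phi> y x v)"
  by (auto simp: graph_bundle_def graph_Aut_vertex[OF connection_Aut]
      dest: base.in_arcsD2 fibre.in_arcsD2)

lemma bundle_verts: "pverts (graph_bundle G \<phi> F) = pverts G \<times> pverts F"
  by (simp add: graph_bundle_def)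

lemma pair_bidirected_digraph_bundle: "pair_bidirected_digraph (graph_bundle G \<phi> F)"
proof unfold_locales
  fix p assume "p \<in> parcs (graph_bundle G \<phi> F)"
  then show "fst p \<in> pverts (graph_bundle G \<phi> F)" "snd p \<in> pverts (graph_bundle G \<phi> F)"
    by (auto simp: graph_bundle_def)
next
  fix p assume "p \<in> parcs (graph_bundle G \<phi> F)"
  then show "fst p \<noteq> snd p"
    by (cases p) (auto simp: bundle_arc_iff dest: base.no_loops' fibre.no_loops')
next
  have "((y, w), (x, v)) \<in> parcs (graph_bundle G \<phi> F)"
    if "((x, v), (y, w)) \<in> parcs (graph_bundle G \<phi> F)" for x v y w
    using that
    by (auto simp: bundle_arc_iff connection_back graph_Aut_vertex[OF connection_Aut]
        intro: base.arcs_symmetric fibre.arcs_symmetric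
        dest: base.in_arcsD2 fibre.in_arcsD2)
  then show "symmetric (with_proj (graph_bundle G \<phi> F))"
    by (auto simp: symmetric_def intro!: symI)
qed

lemma bundle_neighbours:
  assumes "x \<in> pverts G" "v \<in> pverts F"
  shows "parcs (graph_bundle G \<phi> F) `` {(x, v)} =
    (\<lambda>y. (y, \<phi> y x v)) ` (parcs G `` {x}) \<union> Pair x ` (parcs F `` {v})"
  using assms by (auto simp: bundle_arc_iff)

lemma regular_bundle:
  assumes "regular_of_degree G d" "regular_of_degree F e"
  shows "regular_of_degree (graph_bundle G \<phi> F) (d + e)"
  unfolding regular_of_degree_iff_card_neighbours
proof (intro ballI)
  fix p assume "p \<in> pverts (graph_bundle G \<phi> F)"
  then obtain x v where p: "p = (x, v)" and x: "x \<in> pverts G" and v: "v \<in> pverts F"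
    by (auto simp: bundle_verts)
  let ?H = "(\<lambda>y. (y, \<phi> y x v)) ` (parcs G `` {x})" and ?V = "Pair x ` (parcs F `` {v})"
  have G: "finite (parcs G `` {x})" "card (parcs G `` {x}) = d"
    and F: "finite (parcs F `` {v})" "card (parcs F `` {v}) = e"
    using assms x v by (auto simp: regular_of_degree_iff_card_neighbours)
  have "card ?H = d" "card ?V = e"
    using G(2) F(2) by (simp_all add: card_image inj_on_def)
  moreover have "?H \<inter> ?V = {}"
    by (auto dest: base.no_loops')
  ultimately show "finite (parcs (graph_bundle G \<phi> F) `` {p}) \<and>
      card (parcs (graph_bundle G \<phi> F) `` {p}) = d + e"
    using G F unfolding p bundle_neighbours[OF x v] by (simp add: card_Un_disjoint)
qed

text \<open>
  Balance of the loop \<open>x, y, z, y', x\<close> is path independence of transport across the square: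
  the inverse of the half running through \<open>y'\<close> is brought to the other side.
\<close>

lemma balanced_square:
  assumes balanced: "\<forall>l. is_loop G 4 l \<longrightarrow> balanced \<phi> 4 l"
    and xy: "(x, y) \<in> parcs G" and yz: "(y, z) \<in> parcs G"
    and xy': "(x, y') \<in> parcs G" and y'z: "(y', z) \<in> parcs G"
  shows "\<phi> z y (\<phi> y x v) = \<phi> z y' (\<phi> y' x v)"
proof -
  define l :: "nat \<Rightarrow> 'a" where "l = (\<lambda>_. x)(1 := y, 2 := z, 3 := y')"
  have l: "l 0 = x" "l (Suc 0) = y" "l (Suc (Suc 0)) = z"
      "l (Suc (Suc (Suc 0))) = y'" "l (Suc (Suc (Suc (Suc 0)))) = x"
    by (simp_all add: l_def)
  have verts: "x \<in> pverts G" "y \<in> pverts G" "z \<in> pverts G" "y' \<in> pverts G"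
    using xy yz xy' by (auto dest: base.in_arcsD1 base.in_arcsD2)
  have arcs: "(z, y') \<in> parcs G" "(y', x) \<in> parcs G"
    using xy' y'z by (auto intro: base.arcs_symmetric)
  have "is_loop G 4 l"
    using xy yz verts arcs
    by (auto simp: is_loop_def numeral_eq_Suc le_Suc_eq less_Suc_eq l)
  then have "transport \<phi> l 4 = id"
    using balanced by (simp add: balanced_def)
  then have "\<phi> x y' (\<phi> y' z (\<phi> z y (\<phi> y x v))) = v"
    by (simp add: numeral_eq_Suc l fun_eq_iff)
  then show ?thesis
    using connection_back[OF arcs(1)] connection_back[OF arcs(2)] by metis
qed

section \<open>The frame of the bundle\<close>

text \<open>
  Transport from the fibre over the centre \<open>x\<close>. The value of \<open>\<phi> x x\<close> is arbitrary, since there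
  is no arc from \<open>x\<close> to itself, so the fibre over \<open>x\<close> needs a separate case.
\<close>

definition from_centre :: "'a \<Rightarrow> 'a \<Rightarrow> 'b \<Rightarrow> 'b" where
  "from_centre x y = (if y = x then id else \<phi> y x)"

definition horizontal :: "('a \<Rightarrow> 'a) \<Rightarrow> 'a \<times> 'b \<Rightarrow> 'a \<times> 'b" where
  "horizontal h = (\<lambda>(y, w). (h y, \<phi> (h y) y w))"

definition vertical :: "'a \<Rightarrow> ('b \<Rightarrow> 'b) \<Rightarrow> 'a \<times> 'b \<Rightarrow> 'a \<times> 'b" where
  "vertical x t = (\<lambda>(y, w). (y, from_centre x y (t (inv (from_centre x y) w))))"

definition bundle_frame ::
  "nat \<Rightarrow> 'a \<Rightarrow> (nat \<Rightarrow> 'a \<Rightarrow> 'a) \<Rightarrow> (nat \<Rightarrow> 'b \<Rightarrow> 'b) \<Rightarrow> nat \<Rightarrow> 'a \<times> 'b \<Rightarrow> 'a \<times> 'b" where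
  "bundle_frame d x \<eta> \<theta> i = (if i \<le> d then horizontal (\<eta> i) else vertical x (\<theta> (i - d)))"

lemma horizontal_arc:
  assumes "(h y, y) \<in> parcs G" "w \<in> pverts F"
  shows "(horizontal h (y, w), (y, w)) \<in> parcs (graph_bundle G \<phi> F)"
proof -
  have "(y, h y) \<in> parcs G"
    using assms(1) by (rule base.arcs_symmetric)
  then show ?thesis
    using assms
    by (simp add: horizontal_def bundle_arc_iff connection_back
        graph_Aut_vertex[OF connection_Aut] base.in_arcsD1)
qed

lemma vertical_at_centre: "vertical x t (x, w) = (x, t w)"
  by (simp add: vertical_def from_centre_def)

lemma from_centre_Aut:
  assumes "y \<in> unit_ball G x"
  shows "from_centre x y \<in> graph_Aut F"
  using assms connection_Aut base.arcs_symmetric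
  by (auto simp: from_centre_def unit_ball_def id_in_graph_Aut)

text \<open>
  The points of the unit ball of the bundle at \<open>(x, v)\<close> have fibre coordinates that come from the
  unit ball of \<open>v\<close>, so that a frame of \<open>F\<close> at \<open>v\<close> can be applied to them; this is what makes the
  vertical moves meaningful.
\<close>

lemma bundle_unit_ball:
  assumes x: "x \<in> pverts G" and v: "v \<in> pverts F"
    and p: "p \<in> unit_ball (graph_bundle G \<phi> F) (x, v)"
  obtains y w where "p = (y, from_centre x y w)" "y \<in> unit_ball G x" "w \<in> unit_ball F v"
proof -
  obtain y w where yw: "p = (y, w)"
    by (cases p)
  with p consider "y = x" "w = v" | "y = x" "(w, v) \<in> parcs F"
    | "(y, x) \<in> parcs G" "w \<in> pverts F" "v = \<phi> x y w"
    by (auto simp: unit_ball_def bundle_arc_iff)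
  then show thesis
  proof cases
    case 1
    then show ?thesis
      by (intro that[of y v]) (auto simp: yw unit_ball_def from_centre_def)
  next
    case 2
    then show ?thesis
      by (intro that[of y w]) (auto simp: yw unit_ball_def from_centre_def dest: fibre.in_arcsD1)
  next
    case 3
    then have "y \<noteq> x" "w = \<phi> y x v"
      using connection_back[of y x] by (auto dest: base.no_loops')
    then show ?thesis
      using 3 by (intro that[of y v]) (auto simp: yw unit_ball_def from_centre_def dest: base.in_arcsD1)
  qed
qed

text \<open>
  Seen from the fibre over the centre, a vertical move over \<open>y\<close> is \<open>t\<close> itself. Properties of
  vertical moves are thereby inherited from properties of the frame of \<open>F\<close>.
\<close>

lemma vertical_from_centre:
  assumes "y \<in> unit_ball G x"
  shows "vertical x t (y, from_centre x y w) = (y, from_centre x y (t w))"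
  using graph_Aut_bij[OF from_centre_Aut[OF assms]]
  by (simp add: vertical_def bij_is_inj)

lemma vertical_arc:
  assumes y: "y \<in> unit_ball G x" "y \<in> pverts G" and t: "(t w, w) \<in> parcs F"
  shows "(vertical x t (y, from_centre x y w), (y, from_centre x y w))
    \<in> parcs (graph_bundle G \<phi> F)"
  using y graph_Aut_arc[OF from_centre_Aut[OF y(1)] t]
  by (simp add: vertical_from_centre bundle_arc_iff fibre.in_arcsD1)

lemma horizontal_vertical_commute:
  assumes "(h x, x) \<in> parcs G"
  shows "horizontal h (vertical x t (x, v)) = vertical x t (horizontal h (x, v))"
proof -
  have "h x \<in> unit_ball G x" "h x \<noteq> x"
    using assms by (auto simp: unit_ball_def dest: base.in_arcsD1 base.no_loops')
  then show ?thesis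
    using vertical_from_centre[of "h x" x t v]
    by (simp add: horizontal_def vertical_at_centre from_centre_def)
qed

lemma horizontal_commute:
  assumes balanced: "\<forall>l. is_loop G 4 l \<longrightarrow> balanced \<phi> 4 l"
    and "(h x, x) \<in> parcs G" "(h (k x), k x) \<in> parcs G"
    and "(k x, x) \<in> parcs G" "(k (h x), h x) \<in> parcs G"
    and hk: "h (k x) = k (h x)"
  shows "horizontal h (horizontal k (x, v)) = horizontal k (horizontal h (x, v))"
proof -
  have "(x, k x) \<in> parcs G" "(k x, k (h x)) \<in> parcs G"
    "(x, h x) \<in> parcs G" "(h x, k (h x)) \<in> parcs G"
    using assms(2-5) unfolding hk by (auto intro: base.arcs_symmetric)
  from balanced_square[OF balanced this, of v] show ?thesis
    by (simp add: horizontal_def hk)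
qed

lemma commuting_frame_bundle:
  assumes balanced: "\<forall>l. is_loop G 4 l \<longrightarrow> balanced \<phi> 4 l"
    and x: "x \<in> pverts G" and v: "v \<in> pverts F"
    and \<eta>: "commuting_frame G d x \<eta>" and \<theta>: "commuting_frame F e v \<theta>"
  shows "commuting_frame (graph_bundle G \<phi> F) (d + e) (x, v) (bundle_frame d x \<eta> \<theta>)"
    (is "commuting_frame ?B _ _ ?\<zeta>")
proof -
  have \<eta>_arc: "(\<eta> i y, y) \<in> parcs G" if "i \<in> {1..d}" "y \<in> unit_ball G x" for i y
    using \<eta> that by (simp add: commuting_frame_def)
  have \<theta>_arc: "(\<theta> j w, w) \<in> parcs F" if "j \<in> {1..e}" "w \<in> unit_ball F v" for j w
    using \<theta> that by (simp add: commuting_frame_def)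
  have x_ball: "x \<in> unit_ball G x" and v_ball: "v \<in> unit_ball F v"
    by (simp_all add: unit_ball_def)
  have \<eta>_ball: "\<eta> i x \<in> unit_ball G x" if "i \<in> {1..d}" for i
    using \<eta>_arc[OF that x_ball] by (auto simp: unit_ball_def dest: base.in_arcsD1)
  have index: "i \<in> {1..d} \<or> d < i \<and> i - d \<in> {1..e}" if "i \<in> {1..d + e}" for i
    using that by auto
  have hor: "?\<zeta> i = horizontal (\<eta> i)" if "i \<in> {1..d}" for i
    using that by (simp add: bundle_frame_def)
  have ver: "?\<zeta> i = vertical x (\<theta> (i - d))" if "d < i" for i
    using that by (simp add: bundle_frame_def)
  have arc: "(?\<zeta> i p, p) \<in> parcs ?B" if i: "i \<in> {1..d + e}" and p_ball: "p \<in> unit_ball ?B (x, v)" for i p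
  proof -
    obtain y w where p: "p = (y, from_centre x y w)"
      and y: "y \<in> unit_ball G x" and w: "w \<in> unit_ball F v"
      using bundle_unit_ball[OF x v p_ball] .
    have "y \<in> pverts G" "from_centre x y w \<in> pverts F"
      using y w x v by (auto simp: unit_ball_def graph_Aut_vertex[OF from_centre_Aut[OF y]])
    then show ?thesis
      using index[OF i] y w unfolding p
      by (auto simp: hor ver intro!: horizontal_arc vertical_arc \<eta>_arc \<theta>_arc)
  qed
  have inj: "inj_on (\<lambda>i. ?\<zeta> i p) {1..d + e}" if p_ball: "p \<in> unit_ball ?B (x, v)" for p
  proof -
    obtain y w where p: "p = (y, from_centre x y w)"
      and y: "y \<in> unit_ball G x" and w: "w \<in> unit_ball F v"
      using bundle_unit_ball[OF x v p_ball] .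
    have \<psi>: "inj (from_centre x y)"
      using graph_Aut_bij[OF from_centre_Aut[OF y]] by (rule bij_is_inj)
    have \<eta>_inj: "inj_on (\<lambda>i. \<eta> i y) {1..d}" and \<theta>_inj: "inj_on (\<lambda>j. \<theta> j w) {1..e}"
      using \<eta> \<theta> y w by (simp_all add: commuting_frame_def)
    have base_point: "fst (?\<zeta> i p) = (if i \<le> d then \<eta> i y else y)" for i
      by (simp add: p bundle_frame_def horizontal_def vertical_def)
    show ?thesis
    proof (rule inj_onI)
      fix i j
      assume i: "i \<in> {1..d + e}" and j: "j \<in> {1..d + e}" and eq: "?\<zeta> i p = ?\<zeta> j p"
      have base_eq: "(if i \<le> d then \<eta> i y else y) = (if j \<le> d then \<eta> j y else y)"
        using arg_cong[OF eq, of fst] unfolding base_point .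
      have moves: "\<eta> k y \<noteq> y" if "k \<in> {1..d}" for k
        using \<eta>_arc[OF that y] base.no_loops' by fastforce
      \<comment> \<open>Horizontal moves change the base point and vertical moves keep it.\<close>
      have "i \<le> d \<longleftrightarrow> j \<le> d"
        using moves[of i] moves[of j] base_eq i j by (auto split: if_splits)
      then consider "i \<in> {1..d}" "j \<in> {1..d}"
        | "d < i" "i - d \<in> {1..e}" "d < j" "j - d \<in> {1..e}"
        using index[OF i] index[OF j] by fastforce
      then show "i = j"
      proof cases
        case 1
        then show ?thesis
          using base_eq \<eta>_inj by (auto dest: inj_onD)
      next
        case 2
        then have "from_centre x y (\<theta> (i - d) w) = from_centre x y (\<theta> (j - d) w)"
          using eq by (simp add: p ver vertical_from_centre[OF y])
        then have "i - d = j - d"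
          using 2 \<psi> \<theta>_inj by (auto dest: injD inj_onD)
        then show ?thesis
          using 2 by simp
      qed
    qed
  qed
  have comm: "?\<zeta> i (?\<zeta> j (x, v)) = ?\<zeta> j (?\<zeta> i (x, v))"
    if i: "i \<in> {1..d + e}" and j: "j \<in> {1..d + e}" for i j
  proof -
    consider "i \<in> {1..d}" "j \<in> {1..d}"
      | "i \<in> {1..d}" "d < j" | "d < i" "j \<in> {1..d}"
      | "d < i" "i - d \<in> {1..e}" "d < j" "j - d \<in> {1..e}"
      using index[OF i] index[OF j] by blast
    then show ?thesis
    proof cases
      case 1
      moreover have "\<eta> i (\<eta> j x) = \<eta> j (\<eta> i x)"
        using \<eta> 1 by (simp add: commuting_frame_def)
      ultimately show ?thesis
        unfolding hor[OF 1(1)] hor[OF 1(2)]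
        by (intro horizontal_commute[OF balanced] \<eta>_arc \<eta>_ball x_ball)
    next
      case 2
      then show ?thesis
        using horizontal_vertical_commute[of "\<eta> i" x, OF \<eta>_arc[OF 2(1) x_ball]]
        by (simp add: hor ver)
    next
      case 3
      then show ?thesis
        using horizontal_vertical_commute[of "\<eta> j" x, OF \<eta>_arc[OF 3(2) x_ball]]
        by (simp add: hor ver)
    next
      case 4
      then show ?thesis
        using \<theta> by (simp add: ver vertical_at_centre commuting_frame_def)
    qed
  qed
  from arc inj comm show ?thesis
    unfolding commuting_frame_def by blast
qed

end

theorem theorem3:
  fixes G :: "'a pair_pre_digraph" and F :: "'b pair_pre_digraph"
    and \<phi> :: "'a \<Rightarrow> 'a \<Rightarrow> 'b \<Rightarrow> 'b"
  assumes "pair_bidirected_digraph G" "locally_finite G"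
    and "Digraph_Component.connected (with_proj G)" "locally_abelian G"
    and "pair_bidirected_digraph F" "locally_finite F"
    and "Digraph_Component.connected (with_proj F)" "locally_abelian F"
    and "is_connection G F \<phi>"
    and "\<forall>x. is_loop G 4 x \<longrightarrow> balanced \<phi> 4 x"
  shows "locally_abelian (graph_bundle G \<phi> F)"
proof -
  interpret bundle_connection G F \<phi>
    using assms(1,5,9) by (intro bundle_connection.intro bundle_connection_axioms.intro)
  obtain d where d: "regular_of_degree G d" "\<And>x. x \<in> pverts G \<Longrightarrow> \<exists>\<eta>. commuting_frame G d x \<eta>"
    using assms(4) by (auto simp: locally_abelian_iff_commuting_frame)
  obtain e where e: "regular_of_degree F e" "\<And>v. v \<in> pverts F \<Longrightarrow> \<exists>\<theta>. commuting_frame F e v \<theta>"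
    using assms(8) by (auto simp: locally_abelian_iff_commuting_frame)
  have "\<exists>\<zeta>. commuting_frame (graph_bundle G \<phi> F) (d + e) p \<zeta>"
    if "p \<in> pverts (graph_bundle G \<phi> F)" for p
  proof -
    from that obtain x v where p: "p = (x, v)" and "x \<in> pverts G" "v \<in> pverts F"
      by (auto simp: bundle_verts)
    with d(2) e(2) commuting_frame_bundle[OF assms(10)] show ?thesis
      by meson
  qed
  then show ?thesis
    using pair_bidirected_digraph_bundle regular_bundle[OF d(1) e(1)]
    by (auto simp: locally_abelian_iff_commuting_frame)
qed

end
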